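(* Let $F$ be a finite field with $q$ elements, $q$ odd. For $n\geq 2$, the set of (adjacency) eigenvalues of $\mathrm{Um}(F^n)$ is $\{\pm q^{n-1},\ \pm q^{(n-1)/2},\ \pm q^{n/2-1}\}$. For $n\geq 3$, the set of eigenvalues of $\mathrm{Um}_0(F^n)$ is $\{\pm (q^{n-1}-1)/(q-1),\ \pm q^{n/2-1}\}$.
   Context: Dot product on $F^n$: $a\cdot b=\sum_i a_ib_i$. For $n\geq 2$, $\mathrm{Um}(F^n)$ is the bipartite graph whose vertex set consists of two copies $\{a_\bullet\}$ and $\{b_\circ\}$ of the set of non-zero vectors of $F^n$, with $a_\bullet$ adjacent to $b_\circ$ iff $a\cdot b=1$. For $n\geq 3$, $\mathrm{Um}_0(F^n)$ is the bipartite graph on two copies of the projective space $(F^n\setminus\{0\})/F^*$, with $[a]_\bullet$ adjacent to $[b]_\circ$ iff $a\cdot b=0$. Eigenvalues are those of the adjacency matrix of the whole graph. *)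

theory Defs
  imports
    "Jordan_Normal_Form.Spectral_Radius"
    "Graph_Theory.Pair_Digraph"
    "HOL-Library.Cardinality"
begin

text \<open>
  Simple graphs are symmetric loop-free digraphs without parallel arcs (locale \<open>pair_graph\<close>),
  so each edge is present as two arcs. Vectors of \<open>F\<^sup>n\<close> are the elements of \<open>carrier_vec n\<close>, and
  \<open>\<bullet>\<close> is the bilinear product \<open>scalar_prod\<close>.
\<close>

definition adjacency_mat :: "'v pair_pre_digraph \<Rightarrow> 'v list \<Rightarrow> complex mat" where
  "adjacency_mat G vs =
     mat (length vs) (length vs) (\<lambda>(i, j). if (vs ! i, vs ! j) \<in> parcs G then 1 else 0)"

text \<open>
  The enumeration \<open>vs\<close> of the vertices is immaterial: see \<open>adjacency_eigenvalues_eq_spectrum\<close> below.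
  Eigenvalues are taken in the complex numbers.
\<close>

definition adjacency_eigenvalues :: "'v pair_pre_digraph \<Rightarrow> complex set" where
  "adjacency_eigenvalues G =
     (\<Union>vs \<in> {vs. distinct vs \<and> set vs = pverts G}. spectrum (adjacency_mat G vs))"

text \<open>
  The bipartite graph on two copies of \<open>A\<close>: \<open>Inl a\<close> is the black copy of \<open>a\<close> and
  \<open>Inr b\<close> the white copy of \<open>b\<close>.
\<close>

definition bipartite_graph :: "'v set \<Rightarrow> ('v \<times> 'v) set \<Rightarrow> ('v + 'v) pair_pre_digraph" where
  "bipartite_graph A R =
     \<lparr> pverts = A <+> A,
       parcs = {(Inl a, Inr b) | a b. a \<in> A \<and> b \<in> A \<and> (a, b) \<in> R} \<union>
               {(Inr b, Inl a) | a b. a \<in> A \<and> b \<in> A \<and> (a, b) \<in> R} \<rparr>"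

definition nonzero_vecs :: "nat \<Rightarrow> 'a::field vec set" where
  "nonzero_vecs n = carrier_vec n - {0\<^sub>v n}"

definition Um :: "nat \<Rightarrow> ('a::field vec + 'a vec) pair_pre_digraph" where
  "Um n = bipartite_graph (nonzero_vecs n) {(a, b). a \<bullet> b = 1}"

definition proportional :: "nat \<Rightarrow> ('a::field vec \<times> 'a vec) set" where
  "proportional n = {(a, b). a \<in> nonzero_vecs n \<and> b \<in> nonzero_vecs n \<and> (\<exists>c. c \<noteq> 0 \<and> b = c \<cdot>\<^sub>v a)}"

definition proj_space :: "nat \<Rightarrow> 'a::field vec set set" where
  "proj_space n = nonzero_vecs n // proportional n"

definition Um0 :: "nat \<Rightarrow> ('a::field vec set + 'a vec set) pair_pre_digraph" where
  "Um0 n = bipartite_graph (proj_space n)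
     {(proportional n `` {a}, proportional n `` {b}) | a b.
        a \<in> nonzero_vecs n \<and> b \<in> nonzero_vecs n \<and> a \<bullet> b = 0}"

lemma equiv_proportional: "equiv (nonzero_vecs n) (proportional n :: ('a::field vec \<times> 'a vec) set)"
proof (rule equivI)
  show "proportional n \<subseteq> nonzero_vecs n \<times> (nonzero_vecs n :: 'a vec set)"
    by (auto simp: proportional_def)
  show "refl_on (nonzero_vecs n) (proportional n :: ('a vec \<times> 'a vec) set)"
    by (auto simp: refl_on_def proportional_def intro!: exI[of _ 1])
  show "sym (proportional n :: ('a vec \<times> 'a vec) set)"
  proof (rule symI)
    fix a b :: "'a vec" assume "(a, b) \<in> proportional n"
    then obtain c where "a \<in> nonzero_vecs n" "b \<in> nonzero_vecs n" "c \<noteq> 0" "b = c \<cdot>\<^sub>v a"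
      by (auto simp: proportional_def)
    then show "(b, a) \<in> proportional n"
      by (auto simp: proportional_def smult_smult_assoc intro!: exI[of _ "inverse c"])
  qed
  show "trans (proportional n :: ('a vec \<times> 'a vec) set)"
  proof (rule transI)
    fix x y z :: "'a vec" assume "(x, y) \<in> proportional n" "(y, z) \<in> proportional n"
    then obtain c d where "x \<in> nonzero_vecs n" "z \<in> nonzero_vecs n"
      "c \<noteq> 0" "y = c \<cdot>\<^sub>v x" "d \<noteq> 0" "z = d \<cdot>\<^sub>v y"
      by (auto simp: proportional_def)
    then show "(x, z) \<in> proportional n"
      by (auto simp: proportional_def smult_smult_assoc intro!: exI[of _ "d * c"])
  qed
qed

lemma Um_adj_iff:
  fixes a b :: "'a::field vec"
  assumes "a \<in> nonzero_vecs n" "b \<in> nonzero_vecs n"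
  shows "(Inl a, Inr b) \<in> parcs (Um n) \<longleftrightarrow> a \<bullet> b = 1"
  using assms by (auto simp: Um_def bipartite_graph_def)

lemma Um0_adj_iff:
  fixes a b :: "'a::field vec"
  assumes a: "a \<in> nonzero_vecs n" and b: "b \<in> nonzero_vecs n"
  shows "(Inl (proportional n `` {a}), Inr (proportional n `` {b})) \<in> parcs (Um0 n)
           \<longleftrightarrow> a \<bullet> b = 0"
proof
  assume "a \<bullet> b = 0"
  then show "(Inl (proportional n `` {a}), Inr (proportional n `` {b})) \<in> parcs (Um0 n)"
    using assms by (auto simp: Um0_def bipartite_graph_def proj_space_def intro: quotientI)
next
  assume "(Inl (proportional n `` {a}), Inr (proportional n `` {b})) \<in> parcs (Um0 n)"
  then obtain a' b' where *: "a' \<in> nonzero_vecs n" "b' \<in> nonzero_vecs n" "a' \<bullet> b' = 0"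
    and eq: "proportional n `` {a} = proportional n `` {a'}"
      "proportional n `` {b} = proportional n `` {b'}"
    by (auto simp: Um0_def bipartite_graph_def)
  have "(a', a) \<in> proportional n" "(b', b) \<in> proportional n"
    using eq * a b eq_equiv_class_iff[OF equiv_proportional] by metis+
  then obtain c d where "a = c \<cdot>\<^sub>v a'" "b = d \<cdot>\<^sub>v b'"
    by (auto simp: proportional_def)
  moreover have "a' \<in> carrier_vec n" "b' \<in> carrier_vec n"
    using * by (auto simp: nonzero_vecs_def)
  ultimately show "a \<bullet> b = 0"
    using * by simp
qed

lemma pair_graph_bipartite_graph:
  assumes "finite A"
  shows "pair_graph (bipartite_graph A R)"
proof -
  have "finite (parcs (bipartite_graph A R))"
    by (rule finite_subset[of _ "(A <+> A) \<times> (A <+> A)"])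
       (use assms in \<open>auto simp: bipartite_graph_def\<close>)
  moreover have "finite (pverts (bipartite_graph A R))"
    using assms by (simp add: bipartite_graph_def)
  ultimately show ?thesis
    by unfold_locales (auto simp: bipartite_graph_def symmetric_def sym_def)
qed

lemma finite_nonzero_vecs: "finite (nonzero_vecs n :: 'a::{field,finite} vec set)"
proof -
  have "carrier_vec n \<subseteq> vec_of_list ` {xs :: 'a list. set xs \<subseteq> UNIV \<and> length xs = n}"
  proof
    fix v :: "'a vec" assume "v \<in> carrier_vec n"
    then show "v \<in> vec_of_list ` {xs. set xs \<subseteq> UNIV \<and> length xs = n}"
      by (intro image_eqI[of _ _ "list_of_vec v"]) (auto simp: vec_list)
  qed
  then have "finite (carrier_vec n :: 'a vec set)"
    by (rule finite_subset) (intro finite_imageI finite_lists_length_eq finite)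
  then show ?thesis by (simp add: nonzero_vecs_def)
qed

lemma pair_graph_Um: "pair_graph (Um n :: ('a::{field,finite} vec + 'a vec) pair_pre_digraph)"
  unfolding Um_def by (rule pair_graph_bipartite_graph[OF finite_nonzero_vecs])

lemma pair_graph_Um0: "pair_graph (Um0 n :: ('a::{field,finite} vec set + 'a vec set) pair_pre_digraph)"
  unfolding Um0_def proj_space_def
  by (intro pair_graph_bipartite_graph finite_quotient finite_nonzero_vecs)
     (auto simp: proportional_def)

lemma spectrum_adjacency_mat_iff:
  assumes "distinct vs"
  shows "k \<in> spectrum (adjacency_mat G vs) \<longleftrightarrow>
    (\<exists>f. (\<exists>v\<in>set vs. f v \<noteq> 0) \<and>
         (\<forall>v\<in>set vs. (\<Sum>w\<in>set vs. if (v, w) \<in> parcs G then f w else 0) = k * f v))"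
    (is "?L \<longleftrightarrow> ?R")
proof -
  let ?n = "length vs" and ?A = "adjacency_mat G vs"
  have row: "(?A *\<^sub>v x) $ i = (\<Sum>j<?n. if (vs ! i, vs ! j) \<in> parcs G then x $ j else 0)"
    if "i < ?n" "x \<in> carrier_vec ?n" for i x
    using that by (auto simp: adjacency_mat_def scalar_prod_def lessThan_atLeast0 intro!: sum.cong)
  have sum: "(\<Sum>w\<in>set vs. g w) = (\<Sum>j<?n. g (vs ! j))" for g :: "_ \<Rightarrow> complex"
    by (rule sum.reindex_bij_betw[symmetric], rule bij_betw_nth) (use assms in auto)
  have ev: "k \<in> spectrum ?A \<longleftrightarrow> (\<exists>x \<in> carrier_vec ?n. (\<exists>i<?n. x $ i \<noteq> 0) \<and>
    (\<forall>i<?n. (\<Sum>j<?n. if (vs ! i, vs ! j) \<in> parcs G then x $ j else 0) = k * x $ i))"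
    (is "_ \<longleftrightarrow> ?M")
  proof -
    have dim: "dim_row ?A = ?n" by (simp add: adjacency_mat_def)
    have "x \<noteq> 0\<^sub>v ?n \<longleftrightarrow> (\<exists>i<?n. x $ i \<noteq> 0)" if "x \<in> carrier_vec ?n" for x :: "complex vec"
      using that by (auto simp: vec_eq_iff)
    moreover have "?A *\<^sub>v x = k \<cdot>\<^sub>v x \<longleftrightarrow>
        (\<forall>i<?n. (\<Sum>j<?n. if (vs ! i, vs ! j) \<in> parcs G then x $ j else 0) = k * x $ i)"
      if "x \<in> carrier_vec ?n" for x
      using that row[OF _ that] dim by (auto simp: vec_eq_iff simp del: index_mult_mat_vec)
    ultimately show ?thesis
      unfolding spectrum_def eigenvalue_def eigenvector_def dim by blast
  qed
  show ?thesis
  proof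
    assume ?L
    then obtain x where x: "x \<in> carrier_vec ?n" "\<exists>i<?n. x $ i \<noteq> 0"
      "\<forall>i<?n. (\<Sum>j<?n. if (vs ! i, vs ! j) \<in> parcs G then x $ j else 0) = k * x $ i"
      unfolding ev by blast
    define f where "f v = x $ (THE i. i < ?n \<and> vs ! i = v)" for v
    have f: "f (vs ! i) = x $ i" if "i < ?n" for i
    proof -
      have "(THE j. j < ?n \<and> vs ! j = vs ! i) = i"
        by (rule the_equality) (use that assms in \<open>auto simp: nth_eq_iff_index_eq\<close>)
      then show ?thesis by (simp add: f_def)
    qed
    show ?R
    proof (intro exI[of _ f] conjI ballI)
      show "\<exists>v\<in>set vs. f v \<noteq> 0" using x(2) f by (metis nth_mem)
      fix v assume "v \<in> set vs"
      then obtain i where i: "i < ?n" "v = vs ! i" by (auto simp: in_set_conv_nth)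
      have "(\<Sum>w\<in>set vs. if (v, w) \<in> parcs G then f w else 0)
          = (\<Sum>j<?n. if (vs ! i, vs ! j) \<in> parcs G then x $ j else 0)"
        unfolding sum i(2) by (rule sum.cong) (auto simp: f)
      then show "(\<Sum>w\<in>set vs. if (v, w) \<in> parcs G then f w else 0) = k * f v"
        using x(3) i f by simp
    qed
  next
    assume ?R
    then obtain f where f: "\<exists>v\<in>set vs. f v \<noteq> 0"
      "\<forall>v\<in>set vs. (\<Sum>w\<in>set vs. if (v, w) \<in> parcs G then f w else 0) = k * f v"
      by blast
    let ?x = "vec ?n (\<lambda>i. f (vs ! i))"
    have "\<exists>i<?n. ?x $ i \<noteq> 0" using f(1) by (force simp: in_set_conv_nth)
    moreover have "(\<Sum>j<?n. if (vs ! i, vs ! j) \<in> parcs G then ?x $ j else 0) = k * ?x $ i"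
      if "i < ?n" for i
    proof -
      have "(\<Sum>j<?n. if (vs ! i, vs ! j) \<in> parcs G then ?x $ j else 0)
          = (\<Sum>w\<in>set vs. if (vs ! i, w) \<in> parcs G then f w else 0)"
        unfolding sum by (rule sum.cong) auto
      then show ?thesis using f(2) that by simp
    qed
    ultimately show ?L unfolding ev by (intro bexI[of _ ?x]) auto
  qed
qed

lemma adjacency_eigenvalues_eq_spectrum:
  assumes "distinct vs" "set vs = pverts G"
  shows "adjacency_eigenvalues G = spectrum (adjacency_mat G vs)"
proof -
  have "spectrum (adjacency_mat G us) = spectrum (adjacency_mat G vs)"
    if "distinct us" "set us = pverts G" for us
    using that assms by (auto simp: spectrum_adjacency_mat_iff)
  then show ?thesis
    using assms unfolding adjacency_eigenvalues_def by blast
qed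

end

theory Submission
  imports Defs "Berlekamp_Zassenhaus.Berlekamp_Type_Based"
begin

text \<open>
  Both graphs are bipartite with a symmetric biadjacency matrix \<open>N\<close>, so \<open>k\<close> is an eigenvalue iff
  \<open>k\<^sup>2\<close> is an eigenvalue of \<open>N\<^sup>2\<close>, whose entries count common neighbours. Counting solutions of
  one or two linear equations gives \<open>N\<^sup>2 = q\<^sup>n\<^sup>-\<^sup>1 I + q\<^sup>n\<^sup>-\<^sup>2 (J - P)\<close> for \<open>Um\<close>, where \<open>P\<close> is the
  0/1 matrix of proportionality, and \<open>N\<^sup>2 = q\<^sup>n\<^sup>-\<^sup>2 I + (q\<^sup>n\<^sup>-\<^sup>2 - 1) / (q - 1) J\<close> for \<open>Um0\<close>.
  Such a matrix is diagonalised by the constants, the functions of sum zero that are constant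
  on the classes of \<open>P\<close>, and the functions whose sum over each class is zero.
\<close>

section \<open>Spectra of bipartite graphs\<close>

text \<open>With \<open>N\<close> the 0/1 matrix of \<open>R\<close>, symmetric by
  \<open>sym\<close>, the adjacency matrix has zero diagonal blocks and \<open>N\<close> in both
  other blocks, so its square acts as the square of \<open>N\<close> on each copy of
  \<open>A\<close>. The cardinality is the entry of that square at \<open>a\<close>,
  \<open>c\<close>.\<close>

lemma adjacency_eigenvalues_bipartite_graph_iff:
  fixes k :: complex
  assumes fin: "finite A" and sym: "\<And>a b. a \<in> A \<Longrightarrow> b \<in> A \<Longrightarrow> (a, b) \<in> R \<Longrightarrow> (b, a) \<in> R"
  shows "k \<in> adjacency_eigenvalues (bipartite_graph A R) \<longleftrightarrow>
    (\<exists>f. (\<exists>a\<in>A. f a \<noteq> 0) \<and>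
      (\<forall>a\<in>A. (\<Sum>c\<in>A. of_nat (card {b \<in> A. (a, b) \<in> R \<and> (b, c) \<in> R}) * f c) = k\<^sup>2 * f a))"
proof -
  \<comment> \<open>\<open>T\<close> is \<open>N\<close> acting on functions on \<open>A\<close>;
    the eigenvalue equation of the graph becomes a pair of equations in which \<open>T\<close>
    exchanges the two halves of \<open>h\<close>.\<close>
  define T :: "('a \<Rightarrow> complex) \<Rightarrow> 'a \<Rightarrow> complex"
    where "T f a = (\<Sum>b\<in>A. if (a, b) \<in> R then f b else 0)" for f a
  have T_cong: "T f a = T g a" if "\<And>b. b \<in> A \<Longrightarrow> f b = g b" for f g a
    unfolding T_def by (rule sum.cong) (auto simp: that)
  have T_lin: "T (\<lambda>a. x * f a + y * g a) a = x * T f a + y * T g a" for x y f g a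
    unfolding T_def sum_distrib_left sum.distrib[symmetric] by (rule sum.cong) auto
  have T_smult: "T (\<lambda>a. x * f a) a = x * T f a" for x f a
    using T_lin[of x f 0 f] by simp
  have TT: "T (T f) a = (\<Sum>c\<in>A. of_nat (card {b \<in> A. (a, b) \<in> R \<and> (b, c) \<in> R}) * f c)" for f a
  proof -
    have "T (T f) a = (\<Sum>b\<in>A. \<Sum>c\<in>A. if (a, b) \<in> R \<and> (b, c) \<in> R then f c else 0)"
      unfolding T_def by (rule sum.cong) auto
    also have "\<dots> = (\<Sum>c\<in>A. \<Sum>b\<in>A. if (a, b) \<in> R \<and> (b, c) \<in> R then f c else 0)"
      by (rule sum.swap)
    also have "\<dots> = (\<Sum>c\<in>A. of_nat (card {b \<in> A. (a, b) \<in> R \<and> (b, c) \<in> R}) * f c)"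
      by (rule sum.cong) (auto simp: sum.inter_filter[OF fin, symmetric])
    finally show ?thesis .
  qed
  obtain vs where vs: "distinct vs" "set vs = A <+> A"
    using finite_distinct_list[of "A <+> A"] fin by auto
  have pv: "pverts (bipartite_graph A R) = A <+> A"
    by (simp add: bipartite_graph_def)
  have sumPlus: "(\<Sum>w\<in>A <+> A. h w) = (\<Sum>a\<in>A. h (Inl a)) + (\<Sum>b\<in>A. h (Inr b))"
    for h :: "'a + 'a \<Rightarrow> complex"
    using fin by (simp add: sum.Plus)
  have nbL: "(\<Sum>w\<in>A <+> A. if (Inl a, w) \<in> parcs (bipartite_graph A R) then h w else 0)
      = T (h \<circ> Inr) a" if "a \<in> A" for h a
    unfolding sumPlus T_def using that by (auto simp: bipartite_graph_def intro!: sum.cong)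
  have nbR: "(\<Sum>w\<in>A <+> A. if (Inr a, w) \<in> parcs (bipartite_graph A R) then h w else 0)
      = T (h \<circ> Inl) a" if "a \<in> A" for h a
    unfolding sumPlus T_def using that sym
    by (auto simp: bipartite_graph_def intro!: sum.cong)
  have "k \<in> adjacency_eigenvalues (bipartite_graph A R) \<longleftrightarrow>
    (\<exists>h. (\<exists>v\<in>A <+> A. h v \<noteq> 0) \<and> (\<forall>v\<in>A <+> A.
      (\<Sum>w\<in>A <+> A. if (v, w) \<in> parcs (bipartite_graph A R) then h w else 0) = k * h v))"
    using adjacency_eigenvalues_eq_spectrum[OF vs(1), of "bipartite_graph A R"]
      spectrum_adjacency_mat_iff[OF vs(1)] vs(2) pv by simp
  also have "\<dots> \<longleftrightarrow> (\<exists>h. (\<exists>v\<in>A <+> A. h v \<noteq> 0) \<and>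
      (\<forall>a\<in>A. T (h \<circ> Inr) a = k * h (Inl a)) \<and> (\<forall>a\<in>A. T (h \<circ> Inl) a = k * h (Inr a)))"
    using nbL nbR by (auto simp: Plus_def ball_Un)
  also have "\<dots> \<longleftrightarrow> (\<exists>f. (\<exists>a\<in>A. f a \<noteq> 0) \<and> (\<forall>a\<in>A. T (T f) a = k\<^sup>2 * f a))"
  proof
    assume "\<exists>h. (\<exists>v\<in>A <+> A. h v \<noteq> 0) \<and>
      (\<forall>a\<in>A. T (h \<circ> Inr) a = k * h (Inl a)) \<and> (\<forall>a\<in>A. T (h \<circ> Inl) a = k * h (Inr a))"
    then obtain h where nz: "\<exists>v\<in>A <+> A. h v \<noteq> 0"
      and L: "\<And>a. a \<in> A \<Longrightarrow> T (h \<circ> Inr) a = k * (h \<circ> Inl) a"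
      and R: "\<And>a. a \<in> A \<Longrightarrow> T (h \<circ> Inl) a = k * (h \<circ> Inr) a" by auto
    \<comment> \<open>Both halves satisfy the equation for the square of \<open>k\<close>; whichever
      of them is not identically zero serves as \<open>f\<close>.\<close>
    have "T (T (h \<circ> Inl)) a = k\<^sup>2 * (h \<circ> Inl) a" "T (T (h \<circ> Inr)) a = k\<^sup>2 * (h \<circ> Inr) a"
      if "a \<in> A" for a
    proof -
      have "T (T (h \<circ> Inl)) a = k * T (h \<circ> Inr) a" "T (T (h \<circ> Inr)) a = k * T (h \<circ> Inl) a"
        unfolding T_smult[symmetric] by (rule T_cong; simp only: L R)+
      then show "T (T (h \<circ> Inl)) a = k\<^sup>2 * (h \<circ> Inl) a"
        "T (T (h \<circ> Inr)) a = k\<^sup>2 * (h \<circ> Inr) a"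
        by (simp_all only: L[OF that] R[OF that] power2_eq_square mult.assoc)
    qed
    moreover have "(\<exists>a\<in>A. (h \<circ> Inl) a \<noteq> 0) \<or> (\<exists>a\<in>A. (h \<circ> Inr) a \<noteq> 0)"
      using nz by auto
    ultimately show "\<exists>f. (\<exists>a\<in>A. f a \<noteq> 0) \<and> (\<forall>a\<in>A. T (T f) a = k\<^sup>2 * f a)"
      by blast
  next
    assume "\<exists>f. (\<exists>a\<in>A. f a \<noteq> 0) \<and> (\<forall>a\<in>A. T (T f) a = k\<^sup>2 * f a)"
    then obtain f where nz: "\<exists>a\<in>A. f a \<noteq> 0" and f: "\<And>a. a \<in> A \<Longrightarrow> T (T f) a = k\<^sup>2 * f a"
      by blast
    \<comment> \<open>Since \<open>(T - k) (T + k) f = 0\<close>, either \<open>u = (T + k) f\<close> is an eigenvector of \<open>T\<close> for \<open>k\<close>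
      or \<open>f\<close> is one for \<open>-k\<close>.\<close>
    define u where "u a = T f a + k * f a" for a
    have Tu: "T u a = k * u a" if "a \<in> A" for a
      using T_lin[of 1 "T f" k f a] f[OF that]
      by (simp add: u_def[abs_def] power2_eq_square algebra_simps)
    show "\<exists>h. (\<exists>v\<in>A <+> A. h v \<noteq> 0) \<and>
      (\<forall>a\<in>A. T (h \<circ> Inr) a = k * h (Inl a)) \<and> (\<forall>a\<in>A. T (h \<circ> Inl) a = k * h (Inr a))"
    proof (cases "\<exists>a\<in>A. u a \<noteq> 0")
      case True
      \<comment> \<open>An eigenvector of \<open>T\<close> for \<open>k\<close>, repeated on both
        copies, is an eigenvector of the graph for \<open>k\<close>.\<close>
      then show ?thesis
        using Tu by (intro exI[of _ "case_sum u u"]) (auto simp: comp_def Plus_def bex_Un)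
    next
      case False
      then have Tf: "T f a = - k * f a" if "a \<in> A" for a
        using that by (auto simp: u_def add_eq_0_iff)
      \<comment> \<open>An eigenvector of \<open>T\<close> for \<open>- k\<close> is extended with
        opposite sign to the white copy, which turns \<open>- k\<close> into
        \<open>k\<close>.\<close>
      show ?thesis
        using nz Tf T_smult[of "-1" f]
        by (intro exI[of _ "case_sum f (\<lambda>a. - f a)"]) (auto simp: comp_def Plus_def bex_Un)
    qed
  qed
  finally show ?thesis
    unfolding TT .
qed

section \<open>Spectrum of a combination of identity, all-ones matrix and class matrix\<close>

text \<open>The class matrix of \<open>P\<close> multiplies class-constant functions by
  \<open>m\<close> and kills functions with zero class sums. By \<open>two\<close> there are at
  least two classes, so a nonzero class-constant function of total sum zero exists; a nonzero
  function with zero class sums exists iff some class has two elements, whence the condition on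
  \<open>Id\<close>.\<close>

lemma class_kernel_eigenvalue_iff:
  fixes \<alpha> \<beta> \<gamma> \<mu> :: complex
  assumes fin: "finite A" and P: "equiv A P" and m: "\<And>a. a \<in> A \<Longrightarrow> card (P `` {a}) = m"
    and two: "a\<^sub>0 \<in> A" "a\<^sub>1 \<in> A" "(a\<^sub>0, a\<^sub>1) \<notin> P"
    and K: "\<And>a c. a \<in> A \<Longrightarrow> c \<in> A \<Longrightarrow>
      K a c = (if a = c then \<alpha> else 0) + \<beta> - (if (a, c) \<in> P then \<gamma> else 0)"
  shows "(\<exists>f. (\<exists>a\<in>A. f a \<noteq> 0) \<and> (\<forall>a\<in>A. (\<Sum>c\<in>A. K a c * f c) = \<mu> * f a)) \<longleftrightarrow>
    \<mu> \<in> {\<alpha> + \<beta> * of_nat (card A) - \<gamma> * of_nat m, \<alpha> - \<gamma> * of_nat m} \<union> (if P \<subseteq> Id then {} else {\<alpha>})"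
proof -
  define p :: "('a \<Rightarrow> complex) \<Rightarrow> 'a \<Rightarrow> complex" where "p f a = sum f (P `` {a})" for f a
  have PA: "P `` {a} \<subseteq> A" for a
    using P by (auto simp: equiv_def refl_on_def)
  have finP: "finite (P `` {a})" for a
    using PA fin finite_subset by blast
  have cls: "P `` {a} = P `` {b}" if "(a, b) \<in> P" for a b
    using equiv_class_eq[OF P that] .
  have self: "a \<in> P `` {a}" if "a \<in> A" for a
    using equiv_class_self[OF P that] .
  have Kf: "(\<Sum>c\<in>A. K a c * f c) = \<alpha> * f a + \<beta> * sum f A - \<gamma> * p f a" if "a \<in> A" for f a
  proof -
    have "(\<Sum>c\<in>A. K a c * f c) = (\<Sum>c\<in>A. (if a = c then \<alpha> * f c else 0) + \<beta> * f c
        - (if (a, c) \<in> P then \<gamma> * f c else 0))"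
      by (rule sum.cong) (auto simp: K that algebra_simps)
    also have "\<dots> = \<alpha> * f a + \<beta> * sum f A - (\<Sum>c\<in>A. if (a, c) \<in> P then \<gamma> * f c else 0)"
      using that fin by (simp add: sum.distrib sum_subtractf sum_distrib_left)
    also have "(\<Sum>c\<in>A. if (a, c) \<in> P then \<gamma> * f c else 0) = (\<Sum>c\<in>{c\<in>A. (a, c) \<in> P}. \<gamma> * f c)"
      by (rule sum.inter_filter[OF fin, symmetric])
    also have "{c\<in>A. (a, c) \<in> P} = P `` {a}"
      using PA[of a] by auto
    finally show ?thesis
      by (simp add: p_def sum_distrib_left)
  qed
  \<comment> \<open>Double counting: by symmetry of \<open>P\<close>, each \<open>c\<close> lies in
    the classes of exactly \<open>m\<close> elements of \<open>A\<close>.\<close>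
  have sum_p: "sum (p f) A = of_nat m * sum f A" for f
  proof -
    have "sum (p f) A = (\<Sum>a\<in>A. \<Sum>c\<in>A. if (a, c) \<in> P then f c else 0)"
    proof (rule sum.cong)
      fix a assume "a \<in> A"
      have "P `` {a} = {c\<in>A. (a, c) \<in> P}" using PA[of a] by auto
      then show "p f a = (\<Sum>c\<in>A. if (a, c) \<in> P then f c else 0)"
        by (simp add: p_def sum.inter_filter[OF fin, symmetric])
    qed simp
    also have "\<dots> = (\<Sum>c\<in>A. \<Sum>a\<in>A. if (a, c) \<in> P then f c else 0)"
      by (rule sum.swap)
    also have "\<dots> = (\<Sum>c\<in>A. of_nat m * f c)"
    proof (rule sum.cong)
      fix c assume c: "c \<in> A"
      have "P `` {c} = {a\<in>A. (a, c) \<in> P}"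
        using PA[of c] P by (auto simp: equiv_def sym_def)
      then show "(\<Sum>a\<in>A. if (a, c) \<in> P then f c else 0) = of_nat m * f c"
        using m[OF c] by (simp add: sum.inter_filter[OF fin, symmetric])
    qed simp
    finally show ?thesis by (simp add: sum_distrib_left)
  qed
  show ?thesis
  proof
    assume "\<exists>f. (\<exists>a\<in>A. f a \<noteq> 0) \<and> (\<forall>a\<in>A. (\<Sum>c\<in>A. K a c * f c) = \<mu> * f a)"
    then obtain f where nz: "\<exists>a\<in>A. f a \<noteq> 0"
      and f: "\<And>a. a \<in> A \<Longrightarrow> \<alpha> * f a + \<beta> * sum f A - \<gamma> * p f a = \<mu> * f a"
      by (metis Kf)
    \<comment> \<open>Summing the eigenvalue equation over \<open>A\<close> isolates the total of
      \<open>f\<close>: if it is nonzero, \<open>\<mu>\<close> is the first value.\<close>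
    have "sum (\<lambda>a. \<alpha> * f a + \<beta> * sum f A - \<gamma> * p f a) A = (\<Sum>a\<in>A. \<mu> * f a)"
      by (rule sum.cong) (auto simp: f)
    then have tot: "(\<alpha> + \<beta> * of_nat (card A) - \<gamma> * of_nat m) * sum f A = \<mu> * sum f A"
      by (simp add: sum.distrib sum_subtractf sum_distrib_left[symmetric] sum_p algebra_simps)
    \<comment> \<open>Summing over one class instead: once the total vanishes, a nonzero class sum
      forces the second value.\<close>
    have part: "(\<alpha> - \<gamma> * of_nat m) * p f a + \<beta> * of_nat m * sum f A = \<mu> * p f a"
      if a: "a \<in> A" for a
    proof -
      have "sum (\<lambda>c. \<alpha> * f c + \<beta> * sum f A - \<gamma> * p f a) (P `` {a}) = (\<Sum>c\<in>P `` {a}. \<mu> * f c)"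
      proof (rule sum.cong)
        fix c assume c: "c \<in> P `` {a}"
        then have "p f c = p f a" using cls[of a c] by (simp add: p_def)
        then show "\<alpha> * f c + \<beta> * sum f A - \<gamma> * p f a = \<mu> * f c"
          using f[of c] c PA[of a] by auto
      qed simp
      then show ?thesis
        using m[OF a]
        by (simp add: sum.distrib sum_subtractf sum_distrib_left[symmetric] p_def[symmetric]
            algebra_simps)
    qed
    show "\<mu> \<in> {\<alpha> + \<beta> * of_nat (card A) - \<gamma> * of_nat m, \<alpha> - \<gamma> * of_nat m} \<union>
        (if P \<subseteq> Id then {} else {\<alpha>})"
    proof (cases "sum f A = 0")
      case False
      then show ?thesis using tot by simp
    next
      case S: True
      show ?thesis
      proof (cases "\<exists>a\<in>A. p f a \<noteq> 0")
        case True
        then show ?thesis using part S by auto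
      next
        case p0: False
        \<comment> \<open>All class sums vanish here; were the classes singletons, \<open>f\<close>
          itself would vanish.\<close>
        have "\<not> P \<subseteq> Id"
        proof
          assume "P \<subseteq> Id"
          then have "P `` {a} = {a}" if "a \<in> A" for a using self[OF that] by auto
          then show False using nz p0 by (auto simp: p_def)
        qed
        moreover have "\<mu> = \<alpha>" using nz f S p0 by auto
        ultimately show ?thesis by simp
      qed
    qed
  next
    have I: "\<exists>f. (\<exists>a\<in>A. f a \<noteq> 0) \<and> (\<forall>a\<in>A. (\<Sum>c\<in>A. K a c * f c) = \<mu> * f a)"
      if "a \<in> A" "f a \<noteq> 0" "\<And>a. a \<in> A \<Longrightarrow> \<alpha> * f a + \<beta> * sum f A - \<gamma> * p f a = \<mu> * f a" for f a
      using that by (intro exI[of _ f]) (auto simp: Kf)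
    have ind: "sum (\<lambda>c. if c \<in> B then 1 else 0 :: complex) C = of_nat (card (C \<inter> B))"
      if "finite C" for B C :: "'a set"
      using that by (simp add: sum.inter_restrict[symmetric])
    assume "\<mu> \<in> {\<alpha> + \<beta> * of_nat (card A) - \<gamma> * of_nat m, \<alpha> - \<gamma> * of_nat m} \<union>
        (if P \<subseteq> Id then {} else {\<alpha>})"
    then consider "\<mu> = \<alpha> + \<beta> * of_nat (card A) - \<gamma> * of_nat m" | "\<mu> = \<alpha> - \<gamma> * of_nat m"
      | "\<not> P \<subseteq> Id" "\<mu> = \<alpha>"
      by (auto split: if_splits)
    then show "\<exists>f. (\<exists>a\<in>A. f a \<noteq> 0) \<and> (\<forall>a\<in>A. (\<Sum>c\<in>A. K a c * f c) = \<mu> * f a)"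
    proof cases
      case 1
      then show ?thesis
        by (intro I[OF two(1), of "\<lambda>_. 1"]) (auto simp: p_def m)
    next
      case 2
      \<comment> \<open>Difference of the indicators of two distinct classes: class-constant, and of
        total zero because both classes have \<open>m\<close> elements.\<close>
      define f :: "'a \<Rightarrow> complex"
        where "f c = (if c \<in> P `` {a\<^sub>0} then 1 else 0) - (if c \<in> P `` {a\<^sub>1} then 1 else 0)" for c
      have "sum f A = 0"
        using m two PA fin unfolding f_def[abs_def] sum_subtractf by (simp only: ind Int_absorb1) simp
      moreover have "p f a = of_nat m * f a" if a: "a \<in> A" for a
      proof -
        have "f c = f a" if "c \<in> P `` {a}" for c
        proof -
          have "(x, c) \<in> P \<longleftrightarrow> (x, a) \<in> P" for x
            using that P unfolding equiv_def sym_def trans_def by blast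
          then show ?thesis by (simp add: f_def)
        qed
        then show ?thesis using m[OF a] by (simp add: p_def)
      qed
      moreover have "f a\<^sub>0 \<noteq> 0"
        using self[OF two(1)] two(3) P by (auto simp: f_def equiv_def sym_def)
      ultimately show ?thesis
        using 2 two(1) by (intro I[of a\<^sub>0 f]) (auto simp: algebra_simps)
    next
      case 3
      then obtain b\<^sub>0 b\<^sub>1 where b: "(b\<^sub>0, b\<^sub>1) \<in> P" "b\<^sub>0 \<noteq> b\<^sub>1" by auto
      then have bA: "b\<^sub>0 \<in> A" "b\<^sub>1 \<in> A" using P by (auto simp: equiv_def)
      \<comment> \<open>Difference of the indicators of two points of one class, so that every class
        sum is zero.\<close>
      define f :: "'a \<Rightarrow> complex"
        where "f c = (if c \<in> {b\<^sub>0} then 1 else 0) - (if c \<in> {b\<^sub>1} then 1 else 0)" for c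
      have "sum f A = 0"
        using bA fin unfolding f_def[abs_def] sum_subtractf by (simp only: ind) simp
      moreover have "p f a = 0" for a
      proof -
        have "b\<^sub>0 \<in> P `` {a} \<longleftrightarrow> b\<^sub>1 \<in> P `` {a}"
          using b(1) P unfolding equiv_def sym_def trans_def by blast
        then show ?thesis
          using finP[of a] unfolding p_def f_def[abs_def] sum_subtractf
          by (simp only: ind) (cases "b\<^sub>0 \<in> P `` {a}"; simp)
      qed
      moreover have "f b\<^sub>0 \<noteq> 0" using b(2) by (simp add: f_def)
      ultimately show ?thesis
        using 3 bA by (intro I[of b\<^sub>0 f]) auto
    qed
  qed
qed

section \<open>Counting solutions of linear equations\<close>

lemma card_nonzero_vecs: "card (nonzero_vecs n :: 'a::{field,finite} vec set) = CARD('a) ^ n - 1"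
  by (simp add: nonzero_vecs_def card_Diff_singleton card_carrier_vec)

text \<open>Adding \<open>c\<close> times \<open>d\<close> raises the product with \<open>a\<close>
  by \<open>c\<close>. Hence translations along \<open>d\<close>, which preserve \<open>V\<close>,
  give bijections between any two fibres, and \<open>V\<close> is the disjoint union of one fibre
  for each field element.\<close>

lemma card_eq_mult_card_scalar_prod_fibre:
  fixes a d :: "'a::{field,finite} vec"
  assumes V: "V \<subseteq> carrier_vec n" and a: "a \<in> carrier_vec n" and d: "d \<in> carrier_vec n" "a \<bullet> d = 1"
    and shift: "\<And>v c. v \<in> V \<Longrightarrow> v + c \<cdot>\<^sub>v d \<in> V"
  shows "card V = CARD('a) * card {v \<in> V. a \<bullet> v = s}"
proof -
  have fin: "finite V" using V finite_carrier_vec finite_subset by blast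
  have eq: "card {v \<in> V. a \<bullet> v = t} = card {v \<in> V. a \<bullet> v = s}" for t
  proof (rule bij_betw_same_card)
    have sp: "a \<bullet> (v + c \<cdot>\<^sub>v d) = a \<bullet> v + c" if "v \<in> V" for v c
      using that V a d by (auto simp: scalar_prod_add_distrib[of a n])
    have inv: "v + c \<cdot>\<^sub>v d + c' \<cdot>\<^sub>v d = v" if "v \<in> V" "c + c' = 0" for v c c'
    proof -
      have v: "v \<in> carrier_vec n" using that V by auto
      then have "v + c \<cdot>\<^sub>v d + c' \<cdot>\<^sub>v d = v + (c + c') \<cdot>\<^sub>v d"
        using d by (simp add: assoc_add_vec[of _ n] add_smult_distrib_vec)
      also have "(c + c') \<cdot>\<^sub>v d = 0\<^sub>v n" using d that(2) by auto
      finally show ?thesis using v by simp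
    qed
    show "bij_betw (\<lambda>v. v + (s - t) \<cdot>\<^sub>v d) {v \<in> V. a \<bullet> v = t} {v \<in> V. a \<bullet> v = s}"
      by (rule bij_betwI[where g = "\<lambda>v. v + (t - s) \<cdot>\<^sub>v d"]) (auto simp: sp shift inv)
  qed
  have "card V = (\<Sum>t\<in>UNIV. card {v \<in> V. a \<bullet> v = t})"
    by (subst card_UN_disjoint[symmetric]) (auto simp: fin intro!: arg_cong[of _ _ card])
  also have "\<dots> = (\<Sum>t\<in>(UNIV :: 'a set). card {v \<in> V. a \<bullet> v = s})"
    by (intro sum.cong refl eq)
  finally show ?thesis by simp
qed

lemma nonzero_vecs_coordinate:
  assumes "a \<in> nonzero_vecs n"
  obtains i where "i < n" "a $ i \<noteq> 0"
  using assms by (auto simp: nonzero_vecs_def vec_eq_iff)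

lemma card_solutions_one:
  fixes a :: "'a::{field,finite} vec"
  assumes a: "a \<in> nonzero_vecs n"
  shows "card {b \<in> carrier_vec n. a \<bullet> b = s} = CARD('a) ^ (n - 1)"
proof -
  obtain i where i: "i < n" "a $ i \<noteq> 0" using nonzero_vecs_coordinate[OF a] .
  have ac: "a \<in> carrier_vec n" using a by (simp add: nonzero_vecs_def)
  \<comment> \<open>The direction is a unit vector scaled so that its product with \<open>a\<close>
    is 1.\<close>
  have "card (carrier_vec n :: 'a vec set) = CARD('a) * card {b \<in> carrier_vec n. a \<bullet> b = s}"
    by (rule card_eq_mult_card_scalar_prod_fibre[of _ n a "inverse (a $ i) \<cdot>\<^sub>v unit_vec n i"])
       (use ac i in auto)
  moreover have "CARD('a) ^ n = CARD('a) * CARD('a) ^ (n - 1)"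
    using power_minus_mult[of n "CARD('a)"] i by (simp add: mult.commute)
  ultimately show ?thesis by (simp add: card_carrier_vec)
qed

text \<open>The solutions of the first equation form an affine hyperplane. A direction orthogonal to
  \<open>a\<close> with product 1 with \<open>a'\<close> preserves it and cuts it into equal fibres
  of the second equation.\<close>

lemma card_solutions_two:
  fixes a a' :: "'a::{field,finite} vec"
  assumes a: "a \<in> nonzero_vecs n" and a': "a' \<in> nonzero_vecs n" and np: "(a, a') \<notin> proportional n"
  shows "card {b \<in> carrier_vec n. a \<bullet> b = s \<and> a' \<bullet> b = t} = CARD('a) ^ (n - 2)"
proof -
  obtain i where i: "i < n" "a $ i \<noteq> 0" using nonzero_vecs_coordinate[OF a] .
  have ac: "a \<in> carrier_vec n" "a' \<in> carrier_vec n"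
    using a a' by (simp_all add: nonzero_vecs_def)
  \<comment> \<open>If \<open>a'\<close> were a multiple of \<open>a\<close>, coordinate
    \<open>i\<close> would force this factor; so the multiple fails in some coordinate
    \<open>j\<close>.\<close>
  define c where "c = a' $ i / a $ i"
  have "a' \<noteq> c \<cdot>\<^sub>v a"
  proof
    assume eq: "a' = c \<cdot>\<^sub>v a"
    then have "c \<noteq> 0" using a' ac by (auto simp: nonzero_vecs_def)
    then show False using np a a' eq by (auto simp: proportional_def)
  qed
  then obtain j where j: "j < n" "a' $ j \<noteq> c * a $ j"
    using ac by (auto simp: vec_eq_iff)
  \<comment> \<open>The 2x2 minor of the rows \<open>a\<close>, \<open>a'\<close> in columns
    \<open>i\<close>, \<open>j\<close>.\<close>
  define D where "D = a $ i * a' $ j - a $ j * a' $ i"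
  have D: "D \<noteq> 0" using i j by (auto simp: D_def c_def field_simps)
  then have "i \<noteq> j" by (auto simp: D_def)
  \<comment> \<open>Two distinct coordinates exist, so the exponent \<open>n - 2\<close> is not
    truncated.\<close>
  then have n: "2 \<le> n" using i j by auto
  \<comment> \<open>The bracket is orthogonal to \<open>a\<close> and has product \<open>D\<close>
    with \<open>a'\<close>; dividing by \<open>D\<close> normalises the latter to 1.\<close>
  define d where "d = inverse D \<cdot>\<^sub>v (a $ i \<cdot>\<^sub>v unit_vec n j - a $ j \<cdot>\<^sub>v unit_vec n i)"
  have d: "d \<in> carrier_vec n" by (simp add: d_def)
  have "a \<bullet> d = 0" "a' \<bullet> d = 1"
    using ac i j D by (simp_all add: d_def scalar_prod_minus_distrib[of _ n])
      (simp add: D_def field_simps)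
  then have "card {b \<in> carrier_vec n. a \<bullet> b = s} =
      CARD('a) * card {b \<in> {b \<in> carrier_vec n. a \<bullet> b = s}. a' \<bullet> b = t}"
    by (intro card_eq_mult_card_scalar_prod_fibre[of _ n a' d])
       (use ac d in \<open>auto simp: scalar_prod_add_distrib[of _ n]\<close>)
  moreover have "CARD('a) ^ (n - 1) = CARD('a) * CARD('a) ^ (n - 2)"
    using power_minus_mult[of "n - 1" "CARD('a)"] n by (simp add: numeral_2_eq_2 mult.commute)
  ultimately show ?thesis
    by (simp add: card_solutions_one[OF a] conj_assoc)
qed

section \<open>Proportionality classes and counting of projective points\<close>

lemma proportional_Image:
  assumes "a \<in> nonzero_vecs n"
  shows "proportional n `` {a} = (\<lambda>c. c \<cdot>\<^sub>v a) ` (UNIV - {0})"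
proof -
  obtain i where "i < n" "a $ i \<noteq> 0" using nonzero_vecs_coordinate[OF assms] .
  then have "c \<cdot>\<^sub>v a \<noteq> 0\<^sub>v n" if "c \<noteq> 0" for c
    using that assms by (auto simp: vec_eq_iff nonzero_vecs_def)
  then show ?thesis
    using assms by (auto simp: proportional_def nonzero_vecs_def)
qed

lemma card_proportional_Image:
  fixes a :: "'a::{field,finite} vec"
  assumes a: "a \<in> nonzero_vecs n"
  shows "card (proportional n `` {a}) = CARD('a) - 1"
proof -
  obtain i where i: "i < n" "a $ i \<noteq> 0" using nonzero_vecs_coordinate[OF a] .
  have "inj (\<lambda>c. c \<cdot>\<^sub>v a)"
  proof (rule injI)
    fix x y assume "x \<cdot>\<^sub>v a = y \<cdot>\<^sub>v a"
    then have "(x \<cdot>\<^sub>v a) $ i = (y \<cdot>\<^sub>v a) $ i" by simp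
    then show "x = y" using i a by (auto simp: nonzero_vecs_def)
  qed
  then show ?thesis
    unfolding proportional_Image[OF a]
    by (subst card_image) (auto intro: inj_on_subset simp: card_Diff_singleton)
qed

text \<open>A set closed under nonzero scaling is a disjoint union of proportionality classes, each
  of size \<open>CARD('a) - 1\<close>. This turns counts of vectors into counts of projective
  points.\<close>

lemma card_saturated:
  fixes B :: "'a::{field,finite} vec set"
  assumes B: "B \<subseteq> nonzero_vecs n" and sat: "\<And>b c. b \<in> B \<Longrightarrow> c \<noteq> 0 \<Longrightarrow> c \<cdot>\<^sub>v b \<in> B"
  shows "card B = (CARD('a) - 1) * card ((\<lambda>b. proportional n `` {b}) ` B)"
proof -
  let ?C = "(\<lambda>b. proportional n `` {b}) ` B"
  have fin: "finite B" using B finite_nonzero_vecs finite_subset by blast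
  have "\<Union> ?C = B"
  proof
    show "B \<subseteq> \<Union> ?C" 
    proof
      fix b assume "b \<in> B"
      moreover from this have "b \<in> proportional n `` {b}"
        using equiv_class_self[OF equiv_proportional] B by blast
      ultimately show "b \<in> \<Union> ?C" by blast
    qed
    show "\<Union> ?C \<subseteq> B" using B sat by (auto simp: proportional_def)
  qed
  moreover have "(CARD('a) - 1) * card ?C = card (\<Union> ?C)"
  proof (rule card_partition)
    show "finite ?C" "finite (\<Union> ?C)" using fin \<open>\<Union> ?C = B\<close> by auto
    show "card c = CARD('a) - 1" if "c \<in> ?C" for c
      using that B card_proportional_Image by blast
    show "c1 \<inter> c2 = {}" if "c1 \<in> ?C" "c2 \<in> ?C" "c1 \<noteq> c2" for c1 c2
    proof -
      have "c1 \<in> nonzero_vecs n // proportional n" "c2 \<in> nonzero_vecs n // proportional n"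
        using that B by (auto intro: quotientI)
      then show ?thesis using quotient_disj[OF equiv_proportional] that(3) by blast
    qed
  qed
  ultimately show ?thesis by simp
qed

section \<open>The two graphs\<close>

lemma complex_square_eq_iff:
  fixes k :: complex
  shows "0 \<le> x \<Longrightarrow> k\<^sup>2 = complex_of_real x \<longleftrightarrow> k = complex_of_real (sqrt x) \<or> k = - complex_of_real (sqrt x)"
  by (metis of_real_power power2_eq_iff real_sqrt_pow2)

text \<open>Links the integral powers found by counting with the half-integral exponents of the
  eigenvalues.\<close>

lemma sqrt_power_eq_powr: "0 < x \<Longrightarrow> sqrt (x ^ m) = x powr (real m / 2)"
  by (simp add: powr_half_sqrt[symmetric] powr_realpow[symmetric] powr_powr)

lemma nonproportional_exists:
  assumes "2 \<le> n"
  obtains a b :: "'a::field vec"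
  where "a \<in> nonzero_vecs n" "b \<in> nonzero_vecs n" "(a, b) \<notin> proportional n"
proof
  let ?a = "unit_vec n 0 :: 'a vec" and ?b = "unit_vec n 1 :: 'a vec"
  show "?a \<in> nonzero_vecs n" "?b \<in> nonzero_vecs n"
    using assms by (auto simp: nonzero_vecs_def)
  show "(?a, ?b) \<notin> proportional n"
  proof
    assume "(?a, ?b) \<in> proportional n"
    then obtain c where "?b = c \<cdot>\<^sub>v ?a" by (auto simp: proportional_def)
    then have "?b $ 1 = (c \<cdot>\<^sub>v ?a) $ 1" by simp
    then show False using assms by simp
  qed
qed

section \<open>The graph on nonzero vectors\<close>

text \<open>A common neighbour solves two equations with right-hand side 1. They coincide if
  \<open>a = c\<close>, contradict each other if \<open>c\<close> is another multiple of
  \<open>a\<close>, and are independent otherwise.\<close>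

lemma card_common_neighbours_Um:
  fixes a c :: "'a::{field,finite} vec"
  assumes a: "a \<in> nonzero_vecs n" and c: "c \<in> nonzero_vecs n"
  shows "card {b \<in> nonzero_vecs n. (a, b) \<in> {(a, b). a \<bullet> b = 1} \<and> (b, c) \<in> {(a, b). a \<bullet> b = 1}} =
    (if a = c then CARD('a) ^ (n - 1) else if (a, c) \<in> proportional n then 0 else CARD('a) ^ (n - 2))"
proof -
  have ac: "a \<in> carrier_vec n" "c \<in> carrier_vec n"
    using a c by (simp_all add: nonzero_vecs_def)
  \<comment> \<open>The zero vector need not be excluded: its product with \<open>a\<close> is 0,
    not 1.\<close>
  have eq: "{b \<in> nonzero_vecs n. (a, b) \<in> {(a, b). a \<bullet> b = 1} \<and> (b, c) \<in> {(a, b). a \<bullet> b = 1}} =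
      {b \<in> carrier_vec n. a \<bullet> b = 1 \<and> c \<bullet> b = 1}"
    using ac by (auto simp: nonzero_vecs_def comm_scalar_prod[of _ n])
  consider "a = c" | "a \<noteq> c" "(a, c) \<in> proportional n" | "(a, c) \<notin> proportional n" by blast
  then show ?thesis
  proof cases
    case 1
    then show ?thesis unfolding eq using card_solutions_one[OF a, of 1] by simp
  next
    case 2
    then obtain x where x: "c = x \<cdot>\<^sub>v a" by (auto simp: proportional_def)
    with 2(1) have "x \<noteq> 1" by auto
    then have "{b \<in> carrier_vec n. a \<bullet> b = 1 \<and> c \<bullet> b = 1} = {}" using ac x by auto
    with 2 show ?thesis unfolding eq by simp
  next
    case 3
    moreover have "a \<noteq> c"
      using 3 equiv_class_self[OF equiv_proportional a] by auto
    ultimately show ?thesis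
      unfolding eq using card_solutions_two[OF a c, of 1 1] by simp
  qed
qed

lemma finite_field_card_ge_2: "2 \<le> CARD('a::{field,finite})"
  using card_mono[of "UNIV :: 'a set" "{0, 1}"] by simp

text \<open>The class kernel has \<open>\<alpha>\<close> = \<open>q ^ (n - 1)\<close>,
  \<open>\<beta>\<close> = \<open>\<gamma>\<close> = \<open>q ^ (n - 2)\<close> and classes of size
  \<open>q - 1\<close>; its three eigenvalues simplify to the listed powers.\<close>

lemma Um_eigenvalue_iff:
  fixes k :: complex
  assumes n: "2 \<le> n" and q: "CARD('a::{field,finite}) = q" "3 \<le> q"
  shows "k \<in> adjacency_eigenvalues (Um n :: ('a vec + 'a vec) pair_pre_digraph) \<longleftrightarrow>
    k\<^sup>2 \<in> complex_of_real ` {(real q ^ (n - 1))\<^sup>2, real q ^ (n - 1), real q ^ (n - 2)}"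
proof -
  let ?A = "nonzero_vecs n :: 'a vec set" and ?P = "proportional n :: ('a vec \<times> 'a vec) set"
  let ?R = "{(a, b :: 'a vec). a \<bullet> b = 1}"
  let ?\<alpha> = "of_nat q ^ (n - 1) :: complex" and ?\<beta> = "of_nat q ^ (n - 2) :: complex"
  obtain a\<^sub>0 a\<^sub>1 where two: "a\<^sub>0 \<in> ?A" "a\<^sub>1 \<in> ?A" "(a\<^sub>0, a\<^sub>1) \<notin> ?P"
    using nonproportional_exists[OF n] .
  have self: "(a, a) \<in> ?P" if "a \<in> ?A" for a
    using equiv_class_self[OF equiv_proportional that] by simp
  \<comment> \<open>Since \<open>3 \<le> q\<close>, classes have at least two elements, so the
    eigenvalue \<open>\<alpha>\<close> does occur.\<close>
  have nId: "\<not> ?P \<subseteq> Id"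
  proof
    assume "?P \<subseteq> Id"
    then have "?P `` {a\<^sub>0} \<subseteq> {a\<^sub>0}" by auto
    then have "card (?P `` {a\<^sub>0}) \<le> 1" using card_mono[of "{a\<^sub>0}"] by fastforce
    then show False using card_proportional_Image[OF two(1)] q by simp
  qed
  have K: "of_nat (card {b \<in> ?A. (a, b) \<in> ?R \<and> (b, c) \<in> ?R}) =
      (if a = c then ?\<alpha> else 0) + ?\<beta> - (if (a, c) \<in> ?P then ?\<beta> else 0)"
    if "a \<in> ?A" "c \<in> ?A" for a c
    unfolding card_common_neighbours_Um[OF that] q(1) using self[OF that(1)] by auto
  have cl: "card (?P `` {a}) = q - 1" if "a \<in> ?A" for a
    using card_proportional_Image[OF that] q by simp
  have sym: "(b, a) \<in> ?R" if "a \<in> ?A" "b \<in> ?A" "(a, b) \<in> ?R" for a b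
    using that by (auto simp: nonzero_vecs_def comm_scalar_prod[of _ n])
  obtain m where m: "n = m + 2" using n that[of "n - 2"] by simp
  have cA: "of_nat (card ?A) = (of_nat q ^ n - 1 :: complex)" "of_nat (q - 1) = (of_nat q - 1 :: complex)"
    using q by (simp_all add: card_nonzero_vecs of_nat_diff)
  have v: "?\<alpha> + ?\<beta> * of_nat (card ?A) - ?\<beta> * of_nat (q - 1) = complex_of_real ((real q ^ (n - 1))\<^sup>2)"
    "?\<alpha> - ?\<beta> * of_nat (q - 1) = complex_of_real (real q ^ (n - 2))"
    "?\<alpha> = complex_of_real (real q ^ (n - 1))"
    unfolding cA by (simp_all add: m algebra_simps power2_eq_square power_add)
  have "k \<in> adjacency_eigenvalues (Um n :: ('a vec + 'a vec) pair_pre_digraph) \<longleftrightarrow>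
    k\<^sup>2 \<in> {?\<alpha> + ?\<beta> * of_nat (card ?A) - ?\<beta> * of_nat (q - 1), ?\<alpha> - ?\<beta> * of_nat (q - 1)} \<union>
      (if ?P \<subseteq> Id then {} else {?\<alpha>})"
    unfolding Um_def
    by (subst adjacency_eigenvalues_bipartite_graph_iff[OF finite_nonzero_vecs sym], assumption+)
       (rule class_kernel_eigenvalue_iff[OF finite_nonzero_vecs equiv_proportional cl two K])
  then show ?thesis
    unfolding v(1,2) unfolding v(3) using nId by auto
qed

section \<open>The graph on projective points\<close>

text \<open>Proportional vectors are already identified, so the class kernel is applied with
  equality as the relation, \<open>m\<close> = 1 and \<open>\<gamma>\<close> = 0; only the two
  eigenvalues of a combination of identity and all-ones matrix remain.\<close>

lemma Um0_eigenvalue_iff: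
  fixes k :: complex
  assumes n: "3 \<le> n" and q: "CARD('a::{field,finite}) = q"
  shows "k \<in> adjacency_eigenvalues (Um0 n :: ('a vec set + 'a vec set) pair_pre_digraph) \<longleftrightarrow>
    k\<^sup>2 \<in> complex_of_real ` {((real q ^ (n - 1) - 1) / (real q - 1))\<^sup>2, real q ^ (n - 2)}"
proof -
  let ?A = "nonzero_vecs n :: 'a vec set" and ?P = "proportional n :: ('a vec \<times> 'a vec) set"
  let ?\<beta> = "(of_nat q ^ (n - 2) - 1) / (of_nat q - 1) :: complex"
  define R where "R = {(?P `` {a}, ?P `` {b}) | a b. a \<in> ?A \<and> b \<in> ?A \<and> a \<bullet> b = 0}"
  have q2: "2 \<le> q" using finite_field_card_ge_2[where 'a = 'a] q by simp
  have eqcl: "?P `` {a} = ?P `` {b} \<longleftrightarrow> (a, b) \<in> ?P" if "a \<in> ?A" "b \<in> ?A" for a b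
    using eq_equiv_class_iff[OF equiv_proportional that] .
  have proj: "proj_space n = (\<lambda>a. ?P `` {a}) ` ?A"
    by (auto simp: proj_space_def quotient_def)
  have fin: "finite (proj_space n :: 'a vec set set)"
    unfolding proj by (intro finite_imageI finite_nonzero_vecs)
  have adj: "(?P `` {a}, ?P `` {b}) \<in> R \<longleftrightarrow> a \<bullet> b = 0" if "a \<in> ?A" "b \<in> ?A" for a b
    using Um0_adj_iff[OF that] that
    unfolding Um0_def R_def[symmetric] by (auto simp: bipartite_graph_def proj)
  have cardC: "of_nat (card {B \<in> proj_space n. (?P `` {a}, B) \<in> R \<and> (B, ?P `` {c}) \<in> R}) =
      (if ?P `` {a} = ?P `` {c} then of_nat q ^ (n - 2) else 0) + ?\<beta>"
    if ac: "a \<in> ?A" "c \<in> ?A" for a c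
  proof -
    have carr: "a \<in> carrier_vec n" "c \<in> carrier_vec n"
      using ac by (simp_all add: nonzero_vecs_def)
    \<comment> \<open>\<open>S\<close> is the full solution space, counted by the linear lemmas;
      \<open>B\<close> omits the zero vector and is the set that projects onto the common
      neighbours.\<close>
    define B where "B = {b \<in> ?A. a \<bullet> b = 0 \<and> c \<bullet> b = 0}"
    define S where "S = {b \<in> carrier_vec n. a \<bullet> b = 0 \<and> c \<bullet> b = 0}"
    have "B = S - {0\<^sub>v n}" by (auto simp: B_def S_def nonzero_vecs_def)
    moreover have S0: "0\<^sub>v n \<in> S" using carr by (auto simp: S_def)
    ultimately have cB: "card B = card S - 1" by simp
    have "finite S" by (rule finite_subset[OF _ finite_carrier_vec[of n]]) (auto simp: S_def)
    then have S1: "1 \<le> card S" using S0 by (metis card_0_eq empty_iff less_one not_le)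
    have "{B \<in> proj_space n. (?P `` {a}, B) \<in> R \<and> (B, ?P `` {c}) \<in> R} = (\<lambda>b. ?P `` {b}) ` B"
    proof -
      have "(?P `` {a}, ?P `` {b}) \<in> R \<and> (?P `` {b}, ?P `` {c}) \<in> R \<longleftrightarrow> b \<in> B" if b: "b \<in> ?A" for b
      proof -
        have "b \<bullet> c = c \<bullet> b"
          using b carr by (intro comm_scalar_prod[of _ n]) (auto simp: nonzero_vecs_def)
        then show ?thesis
          unfolding adj[OF ac(1) b] adj[OF b ac(2)] using b by (simp add: B_def)
      qed
      moreover have "B \<subseteq> ?A" by (auto simp: B_def)
      ultimately show ?thesis unfolding proj by blast
    qed
    moreover have "card B = (q - 1) * card ((\<lambda>b. ?P `` {b}) ` B)"
      unfolding q[symmetric]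
    proof (rule card_saturated)
      show "B \<subseteq> ?A" by (auto simp: B_def)
      show "x \<cdot>\<^sub>v b \<in> B" if "b \<in> B" "x \<noteq> 0" for b x
      proof -
        have "x \<cdot>\<^sub>v b \<in> ?A"
          using that proportional_Image[of b n] by (auto simp: B_def proportional_def)
        then show ?thesis using that carr by (auto simp: B_def nonzero_vecs_def)
      qed
    qed
    ultimately have "of_nat (card S) - 1 = (of_nat q - 1) *
        (of_nat (card {B \<in> proj_space n. (?P `` {a}, B) \<in> R \<and> (B, ?P `` {c}) \<in> R}) :: complex)"
      using cB S1 q2 by (metis (no_types, lifting) of_nat_1 of_nat_diff of_nat_mult le_trans one_le_numeral)
    moreover have "of_nat q - 1 \<noteq> (0 :: complex)" using q2 by (auto simp: of_nat_eq_1_iff)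
    ultimately have main: "of_nat (card {B \<in> proj_space n. (?P `` {a}, B) \<in> R \<and> (B, ?P `` {c}) \<in> R}) =
        (of_nat (card S) - 1) / (of_nat q - 1 :: complex)"
      by (simp add: field_simps)
    \<comment> \<open>For equal points the two equations are equivalent and \<open>S\<close> has
      \<open>q ^ (n - 1)\<close> elements, otherwise \<open>q ^ (n - 2)\<close>; the quotients by
      \<open>q - 1\<close> differ by exactly \<open>q ^ (n - 2)\<close>.\<close>
    show ?thesis
    proof (cases "(a, c) \<in> ?P")
      case True
      then obtain x where x: "x \<noteq> 0" "c = x \<cdot>\<^sub>v a" by (auto simp: proportional_def)
      then have "S = {b \<in> carrier_vec n. a \<bullet> b = 0}" using carr by (auto simp: S_def)
      then have "card S = q ^ (n - 1)" using card_solutions_one[OF ac(1), of 0] q by simp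
      moreover have "q ^ (n - 1) = q * q ^ (n - 2)"
        using power_minus_mult[of "n - 1" q] n by (simp add: numeral_2_eq_2 mult.commute)
      ultimately show ?thesis
        unfolding main eqcl[OF ac] using True \<open>of_nat q - 1 \<noteq> (0 :: complex)\<close>
        by (simp add: field_simps)
    next
      case False
      then show ?thesis
        unfolding main eqcl[OF ac] S_def using card_solutions_two[OF ac False, of 0 0] q by simp
    qed
  qed
  obtain a\<^sub>0 a\<^sub>1 where two: "a\<^sub>0 \<in> ?A" "a\<^sub>1 \<in> ?A" "(a\<^sub>0, a\<^sub>1) \<notin> ?P"
    using nonproportional_exists[of n, where 'a = 'a] n by auto
  have two': "?P `` {a\<^sub>0} \<in> proj_space n" "?P `` {a\<^sub>1} \<in> proj_space n"
    "(?P `` {a\<^sub>0}, ?P `` {a\<^sub>1}) \<notin> Id_on (proj_space n)"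
    using two eqcl by (auto simp: proj)
  have K: "of_nat (card {B \<in> proj_space n. (X, B) \<in> R \<and> (B, Y) \<in> R}) =
      (if X = Y then of_nat q ^ (n - 2) else 0) + ?\<beta> - (if (X, Y) \<in> Id_on (proj_space n) then 0 else 0)"
    if "X \<in> proj_space n" "Y \<in> proj_space n" for X Y
  proof -
    obtain a c where "a \<in> ?A" "X = ?P `` {a}" "c \<in> ?A" "Y = ?P `` {c}"
      using \<open>X \<in> proj_space n\<close> \<open>Y \<in> proj_space n\<close> unfolding proj by blast
    then show ?thesis using cardC[of a c] by simp
  qed
  have eqv: "equiv (proj_space n) (Id_on (proj_space n :: 'a vec set set))"
    by (auto simp: equiv_def refl_on_def sym_def trans_def)
  have one: "card (Id_on (proj_space n) `` {X}) = 1" if "X \<in> proj_space n" for X :: "'a vec set"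
  proof -
    have "Id_on (proj_space n) `` {X} = {X}" using that by auto
    then show ?thesis by simp
  qed
  have sym: "(Y, X) \<in> R" if "X \<in> proj_space n" "Y \<in> proj_space n" "(X, Y) \<in> R" for X Y
  proof -
    obtain a b where ab: "a \<in> ?A" "X = ?P `` {a}" "b \<in> ?A" "Y = ?P `` {b}"
      using \<open>X \<in> proj_space n\<close> \<open>Y \<in> proj_space n\<close> unfolding proj by blast
    moreover have "a \<bullet> b = b \<bullet> a"
      using ab by (intro comm_scalar_prod[of _ n]) (auto simp: nonzero_vecs_def)
    ultimately show ?thesis using \<open>(X, Y) \<in> R\<close> adj[of a b] adj[of b a] by simp
  qed
  have card_proj: "of_nat (card (proj_space n :: 'a vec set set)) =
      (of_nat q ^ n - 1) / (of_nat q - 1 :: complex)"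
  proof -
    have "card ?A = (CARD('a) - 1) * card (proj_space n :: 'a vec set set)"
      unfolding proj
    proof (rule card_saturated)
      show "x \<cdot>\<^sub>v b \<in> ?A" if "b \<in> ?A" "x \<noteq> 0" for b x
        using that proportional_Image[of b n] by (auto simp: proportional_def)
    qed simp
    then have "of_nat (q ^ n - 1) = (of_nat ((q - 1) * card (proj_space n :: 'a vec set set)) :: complex)"
      by (simp only: card_nonzero_vecs q)
    then have "of_nat q ^ n - 1 = (of_nat q - 1) * (of_nat (card (proj_space n :: 'a vec set set)) :: complex)"
      using q2 by simp
    moreover have "of_nat q - 1 \<noteq> (0 :: complex)" using q2 by (auto simp: of_nat_eq_1_iff)
    ultimately show ?thesis by (simp add: field_simps)
  qed
  obtain m where m: "n = m + 2" using n that[of "n - 2"] by simp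
  have v: "of_nat q ^ (n - 2) + ?\<beta> * of_nat (card (proj_space n :: 'a vec set set)) - 0 * of_nat 1
      = complex_of_real (((real q ^ (n - 1) - 1) / (real q - 1))\<^sup>2)"
    "of_nat q ^ (n - 2) - 0 * of_nat 1 = complex_of_real (real q ^ (n - 2))"
  proof -
    define d :: complex where "d = of_nat q - 1"
    have d: "d \<noteq> 0" using q2 by (auto simp: d_def of_nat_eq_1_iff)
    have qd: "of_nat q = d + 1" by (simp add: d_def)
    \<comment> \<open>Here \<open>Q\<close> stands for \<open>q ^ (n - 2)\<close> and
      \<open>d + 1\<close> for \<open>q\<close>; clearing denominators leaves a polynomial identity,
      which shows the first eigenvalue to be the square of the degree.\<close>
    have "Q + (Q - 1) / d * (((d + 1)\<^sup>2 * Q - 1) / d) = (((d + 1) * Q - 1) / d)\<^sup>2" for Q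
    proof -
      have "Q + (Q - 1) / d * (((d + 1)\<^sup>2 * Q - 1) / d) =
          (Q * d\<^sup>2 + (Q - 1) * ((d + 1)\<^sup>2 * Q - 1)) / d\<^sup>2"
        using d by (simp add: add_divide_distrib power2_eq_square)
      also have "Q * d\<^sup>2 + (Q - 1) * ((d + 1)\<^sup>2 * Q - 1) = ((d + 1) * Q - 1)\<^sup>2"
        by (simp add: power2_eq_square algebra_simps)
      finally show ?thesis by (simp add: power_divide)
    qed
    from this[of "of_nat q ^ m"] show "of_nat q ^ (n - 2) + ?\<beta> * of_nat (card (proj_space n :: 'a vec set set)) - 0 * of_nat 1
      = complex_of_real (((real q ^ (n - 1) - 1) / (real q - 1))\<^sup>2)"
      unfolding card_proj by (simp add: m qd power2_eq_square mult_ac)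
  qed simp
  have "k \<in> adjacency_eigenvalues (Um0 n :: ('a vec set + 'a vec set) pair_pre_digraph) \<longleftrightarrow>
    k\<^sup>2 \<in> {of_nat q ^ (n - 2) + ?\<beta> * of_nat (card (proj_space n :: 'a vec set set)) - 0 * of_nat 1,
      of_nat q ^ (n - 2) - 0 * of_nat 1} \<union>
      (if Id_on (proj_space n :: 'a vec set set) \<subseteq> Id then {} else {of_nat q ^ (n - 2)})"
    unfolding Um0_def R_def[symmetric]
    by (subst adjacency_eigenvalues_bipartite_graph_iff[OF fin sym], assumption+)
       (rule class_kernel_eigenvalue_iff[OF fin eqv one two' K])
  then show ?thesis
    unfolding v by auto
qed

theorem theorem1p4:
  fixes n q :: nat
  assumes "q = CARD('a::{field,finite})" and "odd q"
  shows "(n \<ge> 2 \<longrightarrow>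
      adjacency_eigenvalues (Um n :: ('a vec + 'a vec) pair_pre_digraph) =
        complex_of_real ` {real q ^ (n - 1), - (real q ^ (n - 1)),
          real q powr ((real n - 1) / 2), - (real q powr ((real n - 1) / 2)),
          real q powr (real n / 2 - 1), - (real q powr (real n / 2 - 1))}) \<and>
    (n \<ge> 3 \<longrightarrow>
      adjacency_eigenvalues (Um0 n :: ('a vec set + 'a vec set) pair_pre_digraph) =
        complex_of_real ` {(real q ^ (n - 1) - 1) / (real q - 1),
          - ((real q ^ (n - 1) - 1) / (real q - 1)),
          real q powr (real n / 2 - 1), - (real q powr (real n / 2 - 1))})"
proof -
  have q: "CARD('a) = q" "3 \<le> q"
  proof -
    \<comment> \<open>A field has at least two elements, and oddness rules out exactly two.\<close>
    have "q \<noteq> 2" using assms(2) by auto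
    then show "CARD('a) = q" "3 \<le> q"
      using assms(1) finite_field_card_ge_2[where 'a = 'a] by simp_all
  qed
  have sq: "sqrt (real q ^ (n - 1)) = real q powr ((real n - 1) / 2)"
    "sqrt (real q ^ (n - 2)) = real q powr (real n / 2 - 1)" if "2 \<le> n"
    using that q by (simp_all add: sqrt_power_eq_powr of_nat_diff diff_divide_distrib)
  \<comment> \<open>Nonnegativity makes the degree the square root of its own square.\<close>
  have deg: "0 \<le> (real q ^ (n - 1) - 1) / (real q - 1)"
    using q by (simp add: one_le_power)
  show ?thesis
  proof (intro conjI impI Set.set_eqI)
    fix k :: complex assume n: "2 \<le> n"
    show "k \<in> adjacency_eigenvalues (Um n :: ('a vec + 'a vec) pair_pre_digraph) \<longleftrightarrow>
      k \<in> complex_of_real ` {real q ^ (n - 1), - (real q ^ (n - 1)),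
          real q powr ((real n - 1) / 2), - (real q powr ((real n - 1) / 2)),
          real q powr (real n / 2 - 1), - (real q powr (real n / 2 - 1))}"
      \<comment> \<open>Each admissible value of the square of \<open>k\<close> is a nonnegative
        real and contributes its two opposite roots.\<close>
      unfolding Um_eigenvalue_iff[OF n q] image_insert insert_iff image_empty empty_iff
      by (simp only: complex_square_eq_iff zero_le_power of_nat_0_le_iff sq[OF n] real_sqrt_abs
          abs_of_nonneg of_real_minus disj_assoc simp_thms)
  next
    fix k :: complex assume n: "3 \<le> n"
    then have "2 \<le> n" by simp
    note sq = sq[OF this]
    show "k \<in> adjacency_eigenvalues (Um0 n :: ('a vec set + 'a vec set) pair_pre_digraph) \<longleftrightarrow>
      k \<in> complex_of_real ` {(real q ^ (n - 1) - 1) / (real q - 1),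
          - ((real q ^ (n - 1) - 1) / (real q - 1)),
          real q powr (real n / 2 - 1), - (real q powr (real n / 2 - 1))}"
      unfolding Um0_eigenvalue_iff[OF n q(1)] image_insert insert_iff image_empty empty_iff
      by (simp only: complex_square_eq_iff zero_le_power zero_le_power2 of_nat_0_le_iff sq real_sqrt_abs
          abs_of_nonneg deg of_real_minus disj_assoc simp_thms)
  qed
qed

end
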